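(* Let $N\ge 1$, $\tau>0$, let $f:[0,+\infty)\times[0,+\infty)^{2N}\to\mathbb{R}^N$ be continuous, and consider the delay system $x'(t)=f(t,x(t),x(t-\tau))$. Let $V:(0,+\infty)^N\to(0,+\infty)$ be $C^1$ with $\lim_{|x|\to0}V(x)=0$. Assume: (i) if $x,y\in[0,+\infty)^N$ satisfy $x_j=0$ for some $j\in\{1,\dots,N\}$ and $y\neq0$, then $f_j(t,x,y)>0$ for all $t>0$; (ii) there exist $t_0,r_0>0$ such that $\langle\nabla V(x),f(t,x,y)\rangle>0$ for all $t>t_0$ and all $x,y\in(0,+\infty)^N$ with $V(x),V(y)<r_0$. Then the system is weakly persistent.
   Context: An initial condition is $x_0=\varphi$ with $\varphi:[-\tau,0]\to[0,+\infty)^N$ continuous, where $x_t(s)=x(t+s)$ for $s\in[-\tau,0]$. It is a standing assumption that the system induces a semi-flow $\Phi(t,\varphi)=x_t$ on $C([-\tau,0],[0,+\infty)^N)$: for each such $\varphi$ the solution exists, is unique, is defined for all $t\ge0$ and stays in $[0,+\infty)^N$. Condition (i) is imposed in order that solutions with initial data $\varphi\not\equiv0$ be strictly positive; it is part of the setting that for each such solution $x(t)\in(0,+\infty)^N$ for all sufficiently large $t$, so that $V(x(t))$ is defined there. The system is weakly persistent if $\limsup_{t\to+\infty}|x(t)|>0$ for every solution with continuous initial condition $\varphi:[-\tau,0]\to[0,+\infty)^N$, $\varphi\not\equiv0$. Here $|\cdot|$ is the Euclidean norm and $\langle\cdot,\cdot\rangle$ the Euclidean inner product. *)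

theory Defs
  imports "HOL-Analysis.Analysis"
begin

definition nonneg_orthant :: "(real ^ 'n) set" where
  "nonneg_orthant = {x. \<forall>i. 0 \<le> x $ i}"

definition pos_orthant :: "(real ^ 'n) set" where
  "pos_orthant = {x. \<forall>i. 0 < x $ i}"

definition initial_datum :: "real \<Rightarrow> (real \<Rightarrow> real ^ 'n) \<Rightarrow> bool" where
  "initial_datum \<tau> \<phi> \<longleftrightarrow>
     continuous_on {-\<tau>..0} \<phi> \<and> (\<forall>s\<in>{-\<tau>..0}. \<phi> s \<in> nonneg_orthant)"

definition nontrivial_datum :: "real \<Rightarrow> (real \<Rightarrow> real ^ 'n) \<Rightarrow> bool" where
  "nontrivial_datum \<tau> \<phi> \<longleftrightarrow> initial_datum \<tau> \<phi> \<and> (\<exists>s\<in>{-\<tau>..0}. \<phi> s \<noteq> 0)"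

text \<open>
  Solutions of \<open>x'(t) = f(t, x(t), x(t - \<tau>))\<close> on \<open>[-\<tau>, T)\<close> with initial condition
  \<open>\<phi>\<close> on \<open>[-\<tau>, 0]\<close>; the value \<open>T = \<infinity>\<close> gives global solutions. Since the domain of
  \<open>f\<close> is \<open>[0, \<infinity>) \<times> [0, \<infinity>)\<^sup>N \<times> [0, \<infinity>)\<^sup>N\<close>, a solution has to take values in the closed
  orthant. The derivative within \<open>{0..}\<close> is one-sided at \<open>t = 0\<close> and two-sided for \<open>t > 0\<close>.
\<close>

definition dde_solution ::
  "(real \<Rightarrow> real ^ 'n \<Rightarrow> real ^ 'n \<Rightarrow> real ^ 'n) \<Rightarrow> real \<Rightarrow> (real \<Rightarrow> real ^ 'n) \<Rightarrow>
    ereal \<Rightarrow> (real \<Rightarrow> real ^ 'n) \<Rightarrow> bool" where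
  "dde_solution f \<tau> \<phi> T x \<longleftrightarrow>
     (\<forall>s\<in>{-\<tau>..0}. x s = \<phi> s) \<and>
     continuous_on {t. -\<tau> \<le> t \<and> ereal t < T} x \<and>
     (\<forall>t. 0 \<le> t \<and> ereal t < T \<longrightarrow>
        x t \<in> nonneg_orthant \<and>
        (x has_vector_derivative f t (x t) (x (t - \<tau>))) (at t within {0..}))"

text \<open>
  Well-posedness of the maps \<open>\<Phi>(t, \<phi>) = x\<^sub>t\<close>: every initial datum has a global solution, and
  every local solution is a restriction of it.
\<close>

definition induces_semiflow ::
  "(real \<Rightarrow> real ^ 'n \<Rightarrow> real ^ 'n \<Rightarrow> real ^ 'n) \<Rightarrow> real \<Rightarrow> bool" where
  "induces_semiflow f \<tau> \<longleftrightarrow>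
     (\<forall>\<phi>. initial_datum \<tau> \<phi> \<longrightarrow>
        (\<exists>x. dde_solution f \<tau> \<phi> \<infinity> x \<and>
          (\<forall>T y. 0 < T \<and> dde_solution f \<tau> \<phi> T y \<longrightarrow>
             (\<forall>t. 0 \<le> t \<and> ereal t < T \<longrightarrow> y t = x t))))"

definition eventually_positive ::
  "(real \<Rightarrow> real ^ 'n \<Rightarrow> real ^ 'n \<Rightarrow> real ^ 'n) \<Rightarrow> real \<Rightarrow> bool" where
  "eventually_positive f \<tau> \<longleftrightarrow>
     (\<forall>\<phi> x. nontrivial_datum \<tau> \<phi> \<and> dde_solution f \<tau> \<phi> \<infinity> x \<longrightarrow>
        (\<forall>\<^sub>F t in at_top. x t \<in> pos_orthant))"

definition weakly_persistent ::
  "(real \<Rightarrow> real ^ 'n \<Rightarrow> real ^ 'n \<Rightarrow> real ^ 'n) \<Rightarrow> real \<Rightarrow> bool" where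
  "weakly_persistent f \<tau> \<longleftrightarrow>
     (\<forall>\<phi> x. nontrivial_datum \<tau> \<phi> \<and> dde_solution f \<tau> \<phi> \<infinity> x \<longrightarrow>
        0 < Limsup at_top (\<lambda>t. ereal (norm (x t))))"

end

theory Submission imports Defs begin

text \<open>
  The positive function \<open>V\<close> is small near the origin, and (ii) makes it increase along solutions
  that stay where it is small, so no nontrivial solution can be attracted to the origin. If
  persistence failed, some nontrivial solution would have \<open>limsup |x(t)| = 0\<close> and hence
  converge to \<open>0\<close> (\<open>tendsto_zero_if_Limsup_norm_nonpos\<close>). As
  \<open>x(t)\<close> is eventually in the open orthant, \<open>V(x(t))\<close> would then tend to \<open>0\<close>, so from some time on
  both \<open>V(x(t))\<close> and the delayed value \<open>V(x(t - \<tau>))\<close> would be below the threshold \<open>r\<^sub>0\<close>. By (ii)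
  and the chain rule, \<open>V(x(t))\<close> has positive derivative from that time on. But a positive quantity
  that is eventually increasing stays above one of its positive values and cannot tend to \<open>0\<close>
  (\<open>not_tendsto_zero_if_pos_increasing\<close>).
\<close>

lemma tendsto_zero_if_Limsup_norm_nonpos:
  fixes g :: "'b \<Rightarrow> 'a :: real_normed_vector"
  assumes "Limsup F (\<lambda>t. ereal (norm (g t))) \<le> 0"
  shows "(g \<longlongrightarrow> 0) F"
proof (rule tendstoI)
  fix e :: real assume "e > 0"
  then have "Limsup F (\<lambda>t. ereal (norm (g t))) < ereal e"
    using assms by (auto intro: le_less_trans)
  from Limsup_lessD[OF this] show "\<forall>\<^sub>F t in F. dist (g t) 0 < e"
    by (simp add: dist_norm)
qed

lemma not_tendsto_zero_if_pos_increasing: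
  fixes u :: "real \<Rightarrow> real"
  assumes pos: "u T > 0"
    and deriv: "\<And>t. t \<ge> T \<Longrightarrow> \<exists>d. (u has_real_derivative d) (at t) \<and> d > 0"
  shows "\<not> (u \<longlongrightarrow> 0) at_top"
proof
  assume lim: "(u \<longlongrightarrow> 0) at_top"
  have "u T \<le> u t" if "t \<ge> T" for t
  proof (rule DERIV_nonneg_imp_nondecreasing[OF that])
    fix s assume "T \<le> s" "s \<le> t"
    then show "\<exists>y. (u has_real_derivative y) (at s) \<and> 0 \<le> y"
      using deriv[of s] less_imp_le by blast
  qed
  then have "\<forall>\<^sub>F t in at_top. u T \<le> u t"
    by (rule eventually_at_top_linorderI)
  from tendsto_lowerbound[OF lim this] have "u T \<le> 0" by simp
  with pos show False by simp
qed

lemma has_real_derivative_along_curve: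
  fixes x :: "real \<Rightarrow> 'a :: real_inner"
  assumes "GDERIV V (x t) :> g" and "(x has_vector_derivative v) (at t)"
  shows "((\<lambda>s. V (x s)) has_real_derivative g \<bullet> v) (at t)"
proof -
  have "(V \<circ> x has_derivative (\<lambda>h. h \<bullet> g) \<circ> (\<lambda>h. h *\<^sub>R v)) (at t)"
    using assms by (intro diff_chain_at) (auto simp: gderiv_def has_vector_derivative_def)
  then show ?thesis
    by (simp add: has_field_derivative_def o_def inner_commute mult.commute[of _ "g \<bullet> v"] mult_commute_abs)
qed

text \<open>
  The equation prescribes derivatives within \<open>{0..}\<close>; away from the initial time these are
  two-sided, as the calculus above requires.
\<close>

lemma dde_solution_has_vector_derivative:
  assumes "dde_solution f \<tau> \<phi> \<infinity> x" and "t > 0"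
  shows "(x has_vector_derivative f t (x t) (x (t - \<tau>))) (at t)"
proof -
  have "(x has_vector_derivative f t (x t) (x (t - \<tau>))) (at t within {0..})"
    using assms by (simp add: dde_solution_def)
  moreover have "at t within {0..} = at t"
    using \<open>t > 0\<close> by (intro at_within_interior) simp
  ultimately show ?thesis by simp
qed

theorem proposition1:
  fixes f :: "real \<Rightarrow> real ^ 'n \<Rightarrow> real ^ 'n \<Rightarrow> real ^ 'n"
    and \<tau> :: real
    and V :: "real ^ 'n \<Rightarrow> real"
    and gradV :: "real ^ 'n \<Rightarrow> real ^ 'n"
  assumes "\<tau> > 0"
    and "continuous_on ({0..} \<times> nonneg_orthant \<times> nonneg_orthant) (\<lambda>(t, x, y). f t x y)"
    and "induces_semiflow f \<tau>"
    and "eventually_positive f \<tau>"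
    and "\<And>x. x \<in> pos_orthant \<Longrightarrow> V x > 0"
    and "\<And>x. x \<in> pos_orthant \<Longrightarrow> GDERIV V x :> gradV x"
    and "continuous_on pos_orthant gradV"
    and "(V \<longlongrightarrow> 0) (at 0 within pos_orthant)"
    and "\<And>t x y j. x \<in> nonneg_orthant \<Longrightarrow> y \<in> nonneg_orthant \<Longrightarrow> x $ j = 0 \<Longrightarrow> y \<noteq> 0 \<Longrightarrow>
           t > 0 \<Longrightarrow> f t x y $ j > 0"
    and "\<exists>t0>0. \<exists>r0>0. \<forall>t>t0. \<forall>x\<in>pos_orthant. \<forall>y\<in>pos_orthant.
           V x < r0 \<and> V y < r0 \<longrightarrow> gradV x \<bullet> f t x y > 0"
  shows "weakly_persistent f \<tau>"
  unfolding weakly_persistent_def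
proof (intro allI impI, elim conjE, rule ccontr)
  fix \<phi> x
  assume \<phi>: "nontrivial_datum \<tau> \<phi>" and sol: "dde_solution f \<tau> \<phi> \<infinity> x"
    and "\<not> 0 < Limsup at_top (\<lambda>t. ereal (norm (x t)))"
  then have "(x \<longlongrightarrow> 0) at_top"
    by (intro tendsto_zero_if_Limsup_norm_nonpos) simp
  moreover have pos: "\<forall>\<^sub>F t in at_top. x t \<in> pos_orthant"
    using assms(4) \<phi> sol unfolding eventually_positive_def by blast
  moreover from pos have "\<forall>\<^sub>F t in at_top. x t \<noteq> 0"
    by eventually_elim (auto simp: pos_orthant_def)
  ultimately have "filterlim x (at 0 within pos_orthant) at_top"
    by (auto simp: filterlim_at eventually_conj_iff)
  from filterlim_compose[OF assms(8) this] have V_lim: "((\<lambda>t. V (x t)) \<longlongrightarrow> 0) at_top" .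

  obtain t0 r0 where "r0 > 0" and
    gradV_f: "\<And>t x y. t > t0 \<Longrightarrow> x \<in> pos_orthant \<Longrightarrow> y \<in> pos_orthant \<Longrightarrow> V x < r0 \<Longrightarrow> V y < r0
      \<Longrightarrow> gradV x \<bullet> f t x y > 0"
    using assms(10) by blast
  have "\<forall>\<^sub>F t in at_top. x t \<in> pos_orthant \<and> V (x t) < r0"
    using pos order_tendstoD(2)[OF V_lim \<open>r0 > 0\<close>] by eventually_elim simp
  then obtain S where S: "\<And>t. t \<ge> S \<Longrightarrow> x t \<in> pos_orthant \<and> V (x t) < r0"
    by (auto simp: eventually_at_top_linorder)

  \<comment> \<open>The shift by \<open>\<tau>\<close> keeps the delayed time \<open>t - \<tau>\<close> beyond \<open>S\<close> as well.\<close>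
  define T where "T = max (S + \<tau>) (max t0 0 + 1)"
  have T: "t - \<tau> \<ge> S" "t \<ge> S" "t > t0" "t > 0" if "t \<ge> T" for t
    using that \<open>\<tau> > 0\<close> by (auto simp: T_def)
  have "\<not> ((\<lambda>t. V (x t)) \<longlongrightarrow> 0) at_top"
  proof (rule not_tendsto_zero_if_pos_increasing)
    show "V (x T) > 0"
      using S T(2) assms(5) by blast
    fix t assume "t \<ge> T"
    note t = T[OF this]
    have "((\<lambda>s. V (x s)) has_real_derivative gradV (x t) \<bullet> f t (x t) (x (t - \<tau>))) (at t)"
      using S t assms(6)
      by (intro has_real_derivative_along_curve dde_solution_has_vector_derivative[OF sol]) auto
    moreover have "gradV (x t) \<bullet> f t (x t) (x (t - \<tau>)) > 0"
      using S t by (intro gradV_f) auto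
    ultimately show "\<exists>d. ((\<lambda>s. V (x s)) has_real_derivative d) (at t) \<and> d > 0"
      by blast
  qed
  with V_lim show False by contradiction
qed

end
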